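(* The number $9$ is the only odd infinitary superperfect number. That is, if $N$ is an odd positive integer with $\sigma_\infty(\sigma_\infty(N))=2N$, then $N=9$ (and indeed $\sigma_\infty(\sigma_\infty(9))=18$).
   Context: Infinitary divisors. Every divisor of a positive integer $n$ is a $0$-ary divisor of $n$; for $k\ge 0$, a divisor $d$ of $n$ is a $(k+1)$-ary divisor of $n$ if $d$ and $n/d$ have no common $k$-ary divisor other than $1$. For a prime $p$ and $0\le f\le e$, $p^f$ is called an infinitary divisor of $p^e$ if it is an $(e-1)$-ary divisor of $p^e$. Equivalently (a known characterization due to G. L. Cohen), writing $e=\sum_{i\in I}2^i$ and $f=\sum_{j\in J}2^j$ in binary, $p^f$ is an infinitary divisor of $p^e$ iff $J\subseteq I$. For $n=\prod_i p_i^{e_i}$ (distinct primes $p_i$), a divisor $d=\prod_i p_i^{f_i}$ of $n$ is an infinitary divisor of $n$ iff each $p_i^{f_i}$ is an infinitary divisor of $p_i^{e_i}$. Let $\sigma_\infty(n)$ be the sum of the infinitary divisors of $n$; explicitly, if $e_i=\sum_j y_{ij}2^j$ with $y_{ij}\in\{0,1\}$, then $\sigma_\infty(n)=\prod_i\prod_{j:\,y_{ij}=1}(1+p_i^{2^j})$. A positive integer $N$ is called infinitary superperfect if $\sigma_\infty(\sigma_\infty(N))=2N$. *)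

theory Defs
  imports "HOL-Computational_Algebra.Primes"
begin

fun kary_divisor :: "nat \<Rightarrow> nat \<Rightarrow> nat \<Rightarrow> bool" where
  "kary_divisor 0 d n \<longleftrightarrow> n > 0 \<and> d dvd n"
| "kary_divisor (Suc k) d n \<longleftrightarrow> n > 0 \<and> d dvd n \<and>
     (\<forall>c. kary_divisor k c d \<and> kary_divisor k c (n div d) \<longrightarrow> c = 1)"

text \<open>For \<open>e = 0\<close> the truncated subtraction gives the \<open>0\<close>-ary divisors of \<open>1\<close>, so that
  \<open>1\<close> is an infinitary divisor of \<open>1\<close>.\<close>

definition infinitary_divisor_prime_power :: "nat \<Rightarrow> nat \<Rightarrow> nat \<Rightarrow> bool" where
  "infinitary_divisor_prime_power p f e \<longleftrightarrow> f \<le> e \<and> kary_divisor (e - 1) (p ^ f) (p ^ e)"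

definition infinitary_divisor :: "nat \<Rightarrow> nat \<Rightarrow> bool" where
  "infinitary_divisor d n \<longleftrightarrow> n > 0 \<and> d dvd n \<and>
     (\<forall>p\<in>prime_factors n.
        infinitary_divisor_prime_power p (multiplicity p d) (multiplicity p n))"

definition sigma_infinitary :: "nat \<Rightarrow> nat" where
  "sigma_infinitary n = (\<Sum>d | infinitary_divisor d n. d)"

definition infinitary_superperfect :: "nat \<Rightarrow> bool" where
  "infinitary_superperfect N \<longleftrightarrow> N > 0 \<and> sigma_infinitary (sigma_infinitary N) = 2 * N"

end

theory Submission
  imports Defs "HOL-Library.Nat_Bijection" "HOL-Number_Theory.Residues" "HOL-Analysis.Infinite_Products"
begin

text \<open>
  Every \<open>n > 0\<close> is uniquely a product of distinct numbers \<open>p ^ 2 ^ k\<close> with \<open>p\<close> prime, the infinitary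
  divisors of \<open>n\<close> are the partial products, and so \<open>\<sigma>(n)\<close> is the product of \<open>1 + x\<close> over these factors
  \<open>x\<close>. If \<open>N\<close> is odd and \<open>\<sigma>(\<sigma>(N)) = 2 N\<close>, then \<open>\<sigma>(N)\<close> has exactly one odd factor \<open>Q = q ^ 2 ^ m\<close>,
  because every odd factor contributes a \<open>2\<close> to \<open>2 N\<close>. Hence \<open>2 N\<close> is \<open>1 + Q\<close> times a product of
  distinct Fermat numbers, and every factor \<open>c\<close> of \<open>N\<close> satisfies \<open>1 + c = 2 ^ a * q ^ b\<close>. Primes
  dividing \<open>x\<^sup>2 + 1\<close> are \<open>1\<close> mod \<open>4\<close>, which forces \<open>a = 1\<close> for almost all factors. For \<open>m > 0\<close> the
  product of \<open>\<sigma>(N) / N\<close> and \<open>\<sigma>(\<sigma>(N)) / \<sigma>(N)\<close> is then either more or less than \<open>2\<close>, and for \<open>m = 0\<close>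
  only \<open>N = 9\<close> survives.
\<close>

section \<open>Binary digits and \<open>k\<close>-ary divisors of prime powers\<close>

lemma set_encode_Un_disjoint:
  "finite A \<Longrightarrow> finite B \<Longrightarrow> A \<inter> B = {} \<Longrightarrow> set_encode (A \<union> B) = set_encode A + set_encode B"
  by (simp add: set_encode_def sum.union_disjoint)

text \<open>Adding \<open>f\<close> and \<open>e - f\<close> involves no carry exactly when their
  digit sets are disjoint; then the digits of \<open>e\<close> are the union of the two.\<close>

lemma set_decode_diff_disjoint_iff:
  assumes "f \<le> e"
  shows "set_decode f \<inter> set_decode (e - f) = {} \<longleftrightarrow> set_decode f \<subseteq> set_decode e"
proof
  assume "set_decode f \<inter> set_decode (e - f) = {}"
  hence "set_encode (set_decode f \<union> set_decode (e - f)) = e"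
    using assms by (simp add: set_encode_Un_disjoint)
  hence "set_decode e = set_decode f \<union> set_decode (e - f)"
    by (metis finite_UnI finite_set_decode set_encode_inverse)
  thus "set_decode f \<subseteq> set_decode e" by blast
next
  assume sub: "set_decode f \<subseteq> set_decode e"
  define B where "B = set_decode e - set_decode f"
  have B: "finite B" "set_decode f \<inter> B = {}" "set_decode f \<union> B = set_decode e"
    using sub by (auto simp: B_def)
  have "f + set_encode B = e"
    using set_encode_Un_disjoint[OF finite_set_decode[of f] B(1,2)] B(3) by simp
  hence "e - f = set_encode B" by simp
  thus "set_decode f \<inter> set_decode (e - f) = {}" using B by simp
qed

lemma set_decode_power_2 [simp]: "set_decode (2 ^ k) = {k}"
  using set_encode_inverse[of "{k}"] by (simp add: set_encode_def)

lemma kary_divisor_dvd: "kary_divisor k d n \<Longrightarrow> n > 0 \<and> d dvd n"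
  by (cases k) auto

text \<open>Cohen's criterion. Any level \<open>k\<close> from \<open>e - 1\<close> on is allowed,
  because the induction step needs \<open>p ^ f\<close> and \<open>p ^ (e - f)\<close> at one common
  level.\<close>

theorem kary_divisor_prime_power_iff:
  assumes "prime p" "f \<le> e" "e \<le> Suc k"
  shows "kary_divisor k (p ^ f) (p ^ e) \<longleftrightarrow> set_decode f \<subseteq> set_decode e"
  using assms(2,3)
proof (induction k arbitrary: e f)
  case 0
  have "p ^ f dvd p ^ e" using 0 by (simp add: le_imp_power_dvd)
  moreover have "p ^ e > 0" using assms(1) by (simp add: prime_gt_0_nat)
  moreover have "f = 0 \<or> f = e" using 0 by auto
  ultimately show ?case by auto
next
  case (Suc k)
  have p: "p > 1" using assms(1) by (rule prime_gt_1_nat)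
  have quot: "p ^ e div p ^ f = p ^ (e - f)" using p Suc.prems by (simp add: power_diff)
  have "kary_divisor (Suc k) (p ^ f) (p ^ e) \<longleftrightarrow>
     (\<forall>c. kary_divisor k c (p ^ f) \<and> kary_divisor k c (p ^ (e - f)) \<longrightarrow> c = 1)"
    using p Suc.prems by (simp add: quot le_imp_power_dvd)
  also have "\<dots> \<longleftrightarrow> (\<forall>j. j \<le> f \<and> j \<le> e - f \<and> kary_divisor k (p ^ j) (p ^ f) \<and>
       kary_divisor k (p ^ j) (p ^ (e - f)) \<longrightarrow> j = 0)" (is "?L \<longleftrightarrow> ?R")
  proof
    assume ?L
    thus ?R using assms(1) by (metis prime_power_eq_one_iff)
  next
    assume R: ?R
    show ?L
    proof (intro allI impI)
      fix c assume c: "kary_divisor k c (p ^ f) \<and> kary_divisor k c (p ^ (e - f))"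
      then obtain j where j: "j \<le> f" "c = p ^ j"
        using kary_divisor_dvd divides_primepow_nat[OF assms(1)] by metis
      moreover have "j \<le> e - f"
        using c j p kary_divisor_dvd[of k c] power_dvd_imp_le by blast
      ultimately show "c = 1" using R c by auto
    qed
  qed
  also have "\<dots> \<longleftrightarrow> set_decode f \<inter> set_decode (e - f) = {}"
  \<comment> \<open>For \<open>0 < f < e\<close> both \<open>f\<close> and \<open>e - f\<close> are
    within the bound of the induction hypothesis; at the two extremes both sides hold
    trivially.\<close>
  proof (cases "f = 0 \<or> f = e")
    case False
    have "?R \<longleftrightarrow> (\<forall>j. set_decode j \<subseteq> set_decode f \<and> set_decode j \<subseteq> set_decode (e - f) \<longrightarrow> j = 0)"
    proof -
      have "kary_divisor k (p ^ j) (p ^ f) \<longleftrightarrow> set_decode j \<subseteq> set_decode f" if "j \<le> f" for j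
        using Suc.IH[of j f] Suc.prems False that by simp
      moreover have "kary_divisor k (p ^ j) (p ^ (e - f)) \<longleftrightarrow> set_decode j \<subseteq> set_decode (e - f)"
        if "j \<le> e - f" for j
      proof (rule Suc.IH)
        show "e - f \<le> Suc k" using Suc.prems False by linarith
      qed fact
      ultimately show ?thesis using subset_decode_imp_le by meson
    qed
    also have "\<dots> \<longleftrightarrow> set_decode f \<inter> set_decode (e - f) = {}"
    proof
      assume *: "\<forall>j. set_decode j \<subseteq> set_decode f \<and> set_decode j \<subseteq> set_decode (e - f) \<longrightarrow> j = 0"
      \<comment> \<open>A shared digit \<open>x\<close> would make \<open>2 ^ x\<close> a nonzero
        common exponent.\<close>
      have "x \<notin> set_decode f \<inter> set_decode (e - f)" for x
        using *[rule_format, of "2 ^ x"] by auto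
      thus "set_decode f \<inter> set_decode (e - f) = {}" by blast
    next
      assume "set_decode f \<inter> set_decode (e - f) = {}"
      thus "\<forall>j. set_decode j \<subseteq> set_decode f \<and> set_decode j \<subseteq> set_decode (e - f) \<longrightarrow> j = 0"
        by (metis Int_greatest set_decode_inverse set_encode_empty subset_empty)
    qed
    finally show ?thesis .
  qed auto
  also have "\<dots> \<longleftrightarrow> set_decode f \<subseteq> set_decode e"
    using Suc.prems by (simp add: set_decode_diff_disjoint_iff)
  finally show ?case .
qed

corollary infinitary_divisor_prime_power_iff:
  assumes "prime p"
  shows "infinitary_divisor_prime_power p f e \<longleftrightarrow> set_decode f \<subseteq> set_decode e"
proof -
  have "e \<le> Suc (e - 1)" by simp
  thus ?thesis
    unfolding infinitary_divisor_prime_power_def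
    using kary_divisor_prime_power_iff[OF assms, of f e "e - 1"] subset_decode_imp_le[of f e] by metis
qed

section \<open>Factorization into Fermi-Dirac primes\<close>

text \<open>Fermi-Dirac primes: every positive integer is a product of distinct ones in exactly one way.\<close>

definition fd_primes :: "nat set" where
  "fd_primes = {p ^ 2 ^ k | p k. prime p}"

definition fd_factors :: "nat \<Rightarrow> nat set" where
  "fd_factors n = {p ^ 2 ^ k | p k. prime p \<and> k \<in> set_decode (multiplicity p n)}"

lemma fd_primes_power_eq_iff:
  "prime p \<Longrightarrow> prime r \<Longrightarrow> p ^ 2 ^ k = r ^ 2 ^ j \<longleftrightarrow> p = r \<and> k = j" for p r :: nat
  using prime_power_inj''[of p r "2 ^ k" "2 ^ j"] by auto

lemma fd_factors_power_iff:
  "prime p \<Longrightarrow> p ^ 2 ^ k \<in> fd_factors n \<longleftrightarrow> k \<in> set_decode (multiplicity p n)"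
  by (auto simp: fd_factors_def fd_primes_power_eq_iff)

lemma fd_factors_subset: "fd_factors n \<subseteq> fd_primes"
  by (auto simp: fd_factors_def fd_primes_def)

lemma fd_primes_gt_1: "x \<in> fd_primes \<Longrightarrow> x > 1"
  unfolding fd_primes_def using one_less_power[OF prime_gt_1_nat] by fastforce

lemma fd_factors_dvd:
  assumes "x \<in> fd_factors n" shows "x dvd n"
proof -
  from assms obtain p k where x: "x = p ^ 2 ^ k" "prime p" "k \<in> set_decode (multiplicity p n)"
    by (auto simp: fd_factors_def)
  hence "set_decode (2 ^ k) \<subseteq> set_decode (multiplicity p n)" by simp
  hence "2 ^ k \<le> multiplicity p n" by (rule subset_decode_imp_le)
  thus ?thesis unfolding x(1) by (rule multiplicity_dvd')
qed

lemma finite_fd_factors: "n > 0 \<Longrightarrow> finite (fd_factors n)"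
  by (rule finite_subset[of _ "{..n}"]) (auto dest!: fd_factors_dvd dest: dvd_imp_le)

text \<open>Only the powers of \<open>p\<close> in \<open>X\<close> contribute; their exponents are
  distinct powers of two, so the sum is already in binary.\<close>

lemma multiplicity_prod_fd_primes:
  assumes "finite X" "X \<subseteq> fd_primes" "prime p"
  shows "multiplicity p (\<Prod>X) = set_encode {k. p ^ 2 ^ k \<in> X}"
proof -
  let ?K = "{k. p ^ 2 ^ k \<in> X}"
  have inj: "inj_on (\<lambda>k. p ^ 2 ^ k) ?K"
    using assms(3) fd_primes_power_eq_iff by (auto simp: inj_on_def)
  have "multiplicity p (\<Prod>X) = (\<Sum>x\<in>X. multiplicity p x)"
  proof (rule prime_elem_multiplicity_prod_distrib)
    show "0 \<notin> (\<lambda>x. x) ` X" using assms(2) fd_primes_gt_1[of 0] by auto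
  qed (use assms in auto)
  also have "\<dots> = (\<Sum>x\<in>(\<lambda>k. p ^ 2 ^ k) ` ?K. multiplicity p x)"
  proof (rule sum.mono_neutral_right)
    show "\<forall>x\<in>X - (\<lambda>k. p ^ 2 ^ k) ` ?K. multiplicity p x = 0"
    proof
      fix x assume x: "x \<in> X - (\<lambda>k. p ^ 2 ^ k) ` ?K"
      then obtain r j where r: "x = r ^ 2 ^ j" "prime r"
        using assms(2) by (auto simp: fd_primes_def)
      hence "r \<noteq> p" using x by auto
      thus "multiplicity p x = 0"
        using r assms(3) by (simp add: prime_multiplicity_other prime_elem_multiplicity_power_distrib)
    qed
  qed (use assms in auto)
  also have "\<dots> = (\<Sum>k\<in>?K. 2 ^ k)"
    using assms(3) inj by (simp add: sum.reindex prime_elem_multiplicity_power_distrib)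
  finally show ?thesis by (simp add: set_encode_def)
qed

text \<open>Uniqueness of the factorization: the binary digits of the multiplicities recover
  \<open>X\<close>.\<close>

lemma fd_factors_prod:
  assumes "finite X" "X \<subseteq> fd_primes"
  shows "fd_factors (\<Prod>X) = X"
proof -
  have *: "set_decode (multiplicity p (\<Prod>X)) = {k. p ^ 2 ^ k \<in> X}" if "prime p" for p
  proof -
    have "finite ((\<lambda>k. p ^ 2 ^ k) -` X)"
      using assms(1) that fd_primes_power_eq_iff by (intro finite_vimageI) (auto simp: inj_on_def)
    hence "finite {k. p ^ 2 ^ k \<in> X}" by (simp add: vimage_def)
    thus ?thesis by (simp add: multiplicity_prod_fd_primes[OF assms that])
  qed
  have "x \<in> fd_factors (\<Prod>X) \<longleftrightarrow> x \<in> X" if "x \<in> fd_primes" for x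
    using that * by (auto simp: fd_primes_def fd_factors_power_iff)
  thus ?thesis using assms(2) fd_factors_subset by blast
qed

lemma prod_fd_factors:
  assumes "n > 0" shows "\<Prod>(fd_factors n) = n"
proof (rule multiplicity_eq_nat)
  show "\<Prod>(fd_factors n) > 0"
    by (rule prod_pos) (use fd_factors_subset fd_primes_gt_1 in fastforce)
  show "multiplicity p (\<Prod>(fd_factors n)) = multiplicity p n" if "prime p" for p
    using multiplicity_prod_fd_primes[OF finite_fd_factors[OF assms] fd_factors_subset that]
    by (simp add: fd_factors_power_iff that)
qed fact

section \<open>Infinitary divisors and the product formula\<close>

text \<open>Cohen's criterion at every prime. The condition \<open>d > 0\<close> excludes
  \<open>0\<close>, whose set of factors is empty.\<close>

lemma infinitary_divisor_iff:
  assumes "n > 0"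
  shows "infinitary_divisor d n \<longleftrightarrow> d > 0 \<and> fd_factors d \<subseteq> fd_factors n"
proof
  assume d: "infinitary_divisor d n"
  have "d > 0" using d assms by (auto simp: infinitary_divisor_def intro: Nat.gr0I)
  moreover have "x \<in> fd_factors n" if "x \<in> fd_factors d" for x
  proof -
    from that obtain p k where x: "x = p ^ 2 ^ k" "prime p" "k \<in> set_decode (multiplicity p d)"
      by (auto simp: fd_factors_def)
    hence "multiplicity p d \<noteq> 0" by (metis empty_iff set_decode_zero)
    hence "p dvd d" by (metis not_dvd_imp_multiplicity_0)
    hence "p \<in> prime_factors n"
      using d x(2) by (auto simp: infinitary_divisor_def in_prime_factors_iff)
    hence "set_decode (multiplicity p d) \<subseteq> set_decode (multiplicity p n)"
      using d x(2) infinitary_divisor_prime_power_iff by (auto simp: infinitary_divisor_def)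
    thus ?thesis using x by (auto simp: fd_factors_power_iff)
  qed
  ultimately show "d > 0 \<and> fd_factors d \<subseteq> fd_factors n" by blast
next
  assume d: "d > 0 \<and> fd_factors d \<subseteq> fd_factors n"
  have "\<Prod>(fd_factors d) dvd \<Prod>(fd_factors n)"
    using d finite_fd_factors[OF assms] by (intro prod_dvd_prod_subset) auto
  hence "d dvd n" using d assms by (simp add: prod_fd_factors)
  moreover have "set_decode (multiplicity p d) \<subseteq> set_decode (multiplicity p n)" if "prime p" for p
    using d that fd_factors_power_iff by blast
  ultimately show "infinitary_divisor d n"
    using assms infinitary_divisor_prime_power_iff
    by (auto simp: infinitary_divisor_def in_prime_factors_iff)
qed

text \<open>Expanding the product gives the sum of \<open>\<Prod>X\<close> over all sets
  \<open>X\<close> of factors, and each infinitary divisor is such a product exactly once.\<close>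

theorem sigma_infinitary_eq_prod:
  assumes "n > 0"
  shows "sigma_infinitary n = (\<Prod>x\<in>fd_factors n. 1 + x)"
proof -
  note fin = finite_fd_factors[OF assms]
  have "(\<Prod>x\<in>fd_factors n. 1 + x) = (\<Sum>X\<in>Pow (fd_factors n). \<Prod>X)"
    using prod_add[OF fin, of "\<lambda>x. x" "\<lambda>_. 1"] by (simp add: add.commute)
  also have "\<dots> = (\<Sum>d | infinitary_divisor d n. d)"
  proof (rule sum.reindex_bij_witness[of _ fd_factors "\<lambda>X. \<Prod>X"])
    fix X assume "X \<in> Pow (fd_factors n)"
    hence X: "finite X" "X \<subseteq> fd_primes" "X \<subseteq> fd_factors n"
      using fin fd_factors_subset finite_subset by auto
    thus "fd_factors (\<Prod>X) = X" by (simp add: fd_factors_prod)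
    moreover have "\<Prod>X > 0"
      by (rule prod_pos) (use X fd_primes_gt_1 in fastforce)
    ultimately show "\<Prod>X \<in> {d. infinitary_divisor d n}"
      using X assms by (simp add: infinitary_divisor_iff)
  qed (use assms in \<open>auto simp: infinitary_divisor_iff prod_fd_factors\<close>)
  finally show ?thesis by (simp add: sigma_infinitary_def)
qed

section \<open>Primes dividing squares plus one and Fermat numbers\<close>

text \<open>If \<open>p\<close> were 3 mod 4, raising \<open>x^2 = -1\<close> to the odd power
  \<open>(p - 1) div 2\<close> would contradict Fermat's little theorem.\<close>

lemma prime_dvd_square_plus_1:
  fixes p x :: nat
  assumes "prime p" "odd p" "p dvd x\<^sup>2 + 1"
  shows "p mod 4 = 1"
proof (rule ccontr)
  assume "p mod 4 \<noteq> 1"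
  with \<open>odd p\<close> have "p mod 4 = 3" by presburger
  then obtain n where n: "p - 1 = 2 * n" "odd n"
    by (intro that[of "(p - 1) div 2"]; presburger)
  have "\<not> p dvd x"
  proof
    assume "p dvd x"
    hence "p dvd x\<^sup>2" by (simp add: power2_eq_square)
    hence "p dvd 1" using assms(3) dvd_add_right_iff by blast
    thus False using assms(1) by simp
  qed
  hence 1: "[x ^ (p - 1) = 1] (mod p)" using assms(1) by (rule fermat_theorem[rotated])
  have "[int (x\<^sup>2) = - 1] (mod int p)"
    using assms(3) by (metis cong_iff_dvd_diff diff_minus_eq_add int_dvd_int_iff of_nat_1 of_nat_add)
  hence "[int (x\<^sup>2) ^ n = (- 1) ^ n] (mod int p)" by (rule cong_pow)
  hence "[int (x ^ (p - 1)) = - 1] (mod int p)" using n by (simp add: power_mult)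
  moreover have "[int (x ^ (p - 1)) = 1] (mod int p)"
    using 1 by (metis cong_int_iff of_nat_1)
  ultimately have "[1 = - 1] (mod int p)" using cong_sym cong_trans by blast
  hence "int p dvd 2" by (simp add: cong_iff_dvd_diff)
  hence "p dvd 2" by (metis int_dvd_int_iff of_nat_numeral)
  hence "p \<le> 2" by (simp add: dvd_imp_le)
  thus False using \<open>p mod 4 = 3\<close> by (auto simp: le_less less_Suc_eq numeral_2_eq_2)
qed

text \<open>For \<open>i < j\<close>, \<open>2 ^ 2 ^ j\<close> is an even power of
  \<open>2 ^ 2 ^ i\<close>, so it would be both 1 and -1 modulo \<open>p\<close>.\<close>

lemma prime_dvd_Fermat_numbers_unique:
  fixes p :: nat
  assumes "p dvd 2 ^ 2 ^ i + 1" "p dvd 2 ^ 2 ^ j + 1" "prime p" "odd p"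
  shows "i = j"
proof -
  have False if "p dvd 2 ^ 2 ^ i + 1" "p dvd 2 ^ 2 ^ j + 1" "i < j" for i j
  proof -
    have cong: "[(2::int) ^ 2 ^ i = - 1] (mod int p)"
      using that(1) by (metis (mono_tags) cong_iff_dvd_diff diff_minus_eq_add int_dvd_int_iff of_nat_1 of_nat_add
        of_nat_numeral of_nat_power)
    have "(2::nat) ^ j = 2 ^ i * (2 * 2 ^ (j - i - 1))"
      using that(3) by (simp flip: power_add power_Suc)
    hence "(2::int) ^ 2 ^ j = (2 ^ 2 ^ i) ^ (2 * 2 ^ (j - i - 1))"
      by (simp add: power_mult)
    hence "[(2::int) ^ 2 ^ j = 1] (mod int p)"
      using cong_pow[OF cong, of "2 * 2 ^ (j - i - 1)"] by simp
    moreover have "[(2::int) ^ 2 ^ j = - 1] (mod int p)"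
      using that(2) by (metis (mono_tags) cong_iff_dvd_diff diff_minus_eq_add int_dvd_int_iff of_nat_1 of_nat_add
        of_nat_numeral of_nat_power)
    ultimately have "[1 = - 1] (mod int p)" using cong_sym cong_trans by blast
    hence "int p dvd 2" by (simp add: cong_iff_dvd_diff)
    hence "p dvd 2" by (metis int_dvd_int_iff of_nat_numeral)
    thus False using assms(3,4) by (metis primes_dvd_imp_eq two_is_prime_nat dvd_refl)
  qed
  thus ?thesis using assms(1,2) by (meson nat_neq_iff)
qed

section \<open>Auxiliary estimates and residues modulo 4\<close>

lemma prod_power_eq_power_set_encode: "finite S \<Longrightarrow> (\<Prod>i\<in>S. a ^ 2 ^ i) = a ^ set_encode S"
  by (simp add: set_encode_def power_sum)

text \<open>Telescopes by \<open>(1 - y) * (1 + y) = 1 - y^2\<close>; \<open>4 / 3\<close> is the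
  inverse of the initial \<open>1 - 1 / 4\<close>.\<close>

lemma prod_Fermat_inverse:
  "(\<Prod>i=1..n. 1 + 1 / 2 ^ 2 ^ i) = 4 / 3 * (1 - 1 / 2 ^ 2 ^ Suc n :: real)"
proof (induction n)
  case (Suc n)
  define x :: real where "x = 2 ^ 2 ^ Suc n"
  have "x > 0" by (simp add: x_def)
  have x2: "2 ^ 2 ^ Suc (Suc n) = x * x"
    by (simp add: x_def mult_2 flip: power_add)
  have "(\<Prod>i=1..Suc n. 1 + 1 / 2 ^ 2 ^ i) = (1 + 1 / x) * (4 / 3 * (1 - 1 / x))"
    unfolding x_def Suc.IH[symmetric] by (rule prod.nat_ivl_Suc') simp
  also have "\<dots> = 4 / 3 * (1 - 1 / (x * x))" using \<open>x > 0\<close> by (simp add: field_simps)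
  finally show ?case unfolding x2 .
qed simp

lemma prod_Fermat_le:
  assumes "finite S" "0 \<notin> S"
  shows "3 * (\<Prod>i\<in>S. 1 + 2 ^ 2 ^ i) \<le> 4 * (2::nat) ^ set_encode S"
proof -
  \<comment> \<open>\<open>insert 0\<close> gives \<open>Max\<close> a value when \<open>S\<close>
    is empty.\<close>
  have "(\<Prod>i\<in>S. 1 + 1 / 2 ^ 2 ^ i :: real) \<le> (\<Prod>i=1..Max (insert 0 S). 1 + 1 / 2 ^ 2 ^ i)"
  proof (rule prod_mono2)
    show "S \<subseteq> {1..Max (insert 0 S)}"
    proof
      fix i assume "i \<in> S"
      hence "i \<noteq> 0" "i \<le> Max (insert 0 S)" using assms by (metis, simp)
      thus "i \<in> {1..Max (insert 0 S)}" by simp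
    qed
  qed (auto simp: add_nonneg_nonneg)
  also have "\<dots> \<le> 4 / 3" unfolding prod_Fermat_inverse by simp
  finally have "(\<Prod>i\<in>S. 1 + 1 / 2 ^ 2 ^ i :: real) * (\<Prod>i\<in>S. 2 ^ 2 ^ i) \<le> 4 / 3 * (\<Prod>i\<in>S. 2 ^ 2 ^ i)"
    by (intro mult_right_mono prod_nonneg) auto
  also have "(\<Prod>i\<in>S. 1 + 1 / 2 ^ 2 ^ i :: real) * (\<Prod>i\<in>S. 2 ^ 2 ^ i) = (\<Prod>i\<in>S. 1 + 2 ^ 2 ^ i)"
    unfolding prod.distrib[symmetric] by (intro prod.cong) (auto simp: field_simps)
  finally have "3 * (\<Prod>i\<in>S. 1 + 2 ^ 2 ^ i) \<le> 4 * (2::real) ^ set_encode S"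
    using assms(1) by (simp add: prod_power_eq_power_set_encode)
  hence "real (3 * (\<Prod>i\<in>S. 1 + 2 ^ 2 ^ i)) \<le> real (4 * 2 ^ set_encode S)" by simp
  thus ?thesis by (simp only: of_nat_le_iff)
qed

text \<open>The exponents are distinct and positive, so the geometric series with ratio 1/3 is an
  upper bound.\<close>

lemma sum_inverse_powers_le:
  fixes q :: nat
  assumes "finite A" "0 \<notin> A" "q \<ge> 3"
  shows "(\<Sum>b\<in>A. 1 / real q ^ b) \<le> 1 / 2"
proof -
  have geom: "(\<Sum>b=1..n. 1 / 3 ^ b) = (1 - 1 / 3 ^ n) / (2 :: real)" for n :: nat
    by (induction n) (simp_all add: add_divide_distrib diff_divide_distrib)
  have "(\<Sum>b\<in>A. 1 / real q ^ b) \<le> (\<Sum>b\<in>A. 1 / 3 ^ b)"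
    using assms(3) by (intro sum_mono divide_left_mono power_mono) auto
  also have "\<dots> \<le> (\<Sum>b=1..Max (insert 0 A). 1 / 3 ^ b)"
  proof (rule sum_mono2)
    show "A \<subseteq> {1..Max (insert 0 A)}"
    proof
      fix i assume "i \<in> A"
      hence "i \<noteq> 0" "i \<le> Max (insert 0 A)" using assms by (metis, simp)
      thus "i \<in> {1..Max (insert 0 A)}" by simp
    qed
  qed auto
  also have "\<dots> \<le> 1 / 2" unfolding geom by simp
  finally show ?thesis .
qed

text \<open>For \<open>j > 0\<close> the power is a square. This serves both the Fermat numbers
  after the first and \<open>1 + q ^ 2 ^ m\<close> with \<open>m > 0\<close>.\<close>

lemma prime_dvd_power_plus_1_mod_4:
  fixes p x :: nat
  assumes "prime p" "odd p" "p dvd 1 + x ^ 2 ^ j" "j > 0"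
  shows "p mod 4 = 1"
proof -
  have "x ^ 2 ^ j = (x ^ 2 ^ (j - 1))\<^sup>2"
    using assms(4) by (cases j) (simp_all flip: power_mult add: mult.commute)
  thus ?thesis using assms prime_dvd_square_plus_1[of p "x ^ 2 ^ (j - 1)"]
    by (simp add: add.commute)
qed

lemma power_mod_4_eq_1: "p mod 4 = 1 \<Longrightarrow> p ^ n mod 4 = 1" for p n :: nat
  using power_mod[of p 4 n] by simp

section \<open>Structure of an odd solution\<close>

text \<open>\<open>S\<close> is the set of binary digits of the exponent of \<open>2\<close> in \<open>\<sigma>(N)\<close>, whose odd part is \<open>q ^ 2 ^ m\<close>.\<close>

locale odd_solution =
  fixes N q m :: nat and S :: "nat set"
  assumes N_odd: "odd N" and q: "prime q" "odd q" and S: "finite S"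
    and sigma_N: "(\<Prod>c\<in>fd_factors N. 1 + c) = 2 ^ set_encode S * q ^ 2 ^ m"
    and sigma_sigma_N: "2 * N = (\<Prod>i\<in>S. 1 + 2 ^ 2 ^ i) * (1 + q ^ 2 ^ m)"
begin

lemma N_pos: "N > 0" using N_odd by (rule odd_pos)

lemma q_ge_3: "q \<ge> 3"
  using q prime_ge_2_nat[of q] by (cases "q = 2") auto

lemmas finite_factors = finite_fd_factors[OF N_pos]

lemma factor_gt_1: "c \<in> fd_factors N \<Longrightarrow> c > 1"
  using fd_factors_subset fd_primes_gt_1 by blast

lemma factor_odd: "c \<in> fd_factors N \<Longrightarrow> odd c"
  using fd_factors_dvd N_odd dvd_trans by blast

lemma factorE:
  assumes "c \<in> fd_factors N"
  obtains p k where "c = p ^ 2 ^ k" "prime p" "odd p" "p dvd N"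
proof -
  from assms obtain p k where c: "c = p ^ 2 ^ k" "prime p" by (auto simp: fd_factors_def)
  have "p dvd c" unfolding c(1) by (intro dvd_power) simp
  hence "p dvd N" using fd_factors_dvd[OF assms] dvd_trans by blast
  moreover from this have "odd p" using N_odd dvd_trans by blast
  ultimately show ?thesis using c that by blast
qed

lemma prime_dvd_N_cases:
  assumes "prime p" "p dvd N"
  obtains i where "i \<in> S" "p dvd 1 + 2 ^ 2 ^ i" | "p dvd 1 + q ^ 2 ^ m"
proof -
  have "p dvd (\<Prod>i\<in>S. 1 + 2 ^ 2 ^ i) * (1 + q ^ 2 ^ m)"
    using assms sigma_sigma_N by (metis dvd_mult)
  thus ?thesis
    unfolding prime_dvd_mult_iff[OF assms(1)] prime_dvd_prod_iff[OF S assms(1)] using that by blast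
qed

lemma factor_plus_1_dvd: "c \<in> fd_factors N \<Longrightarrow> 1 + c dvd 2 ^ set_encode S * q ^ 2 ^ m"
  unfolding sigma_N[symmetric] using finite_factors by (rule dvd_prodI)

text \<open>As \<open>1 + c\<close> is 2 mod 4, its half is odd and divides the odd part
  \<open>q ^ 2 ^ m\<close> of \<open>\<sigma>(N)\<close>; \<open>b = 0\<close> would mean
  \<open>c = 1\<close>.\<close>

lemma factor_mod_4E:
  assumes "c \<in> fd_factors N" "c mod 4 = 1"
  obtains b where "b > 0" "b \<le> 2 ^ m" "1 + c = 2 * q ^ b"
proof -
  obtain d where d: "1 + c = 2 * d" "odd d"
    using assms(2) by (intro that[of "(1 + c) div 2"]; presburger)
  have "d dvd 2 ^ set_encode S * q ^ 2 ^ m"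
    using factor_plus_1_dvd[OF assms(1)] d(1) by (metis dvd_mult_right)
  hence "d dvd q ^ 2 ^ m"
    using d(2) by (simp add: coprime_dvd_mult_right_iff)
  then obtain b where b: "b \<le> 2 ^ m" "d = q ^ b"
    using divides_primepow_nat[OF q(1)] by blast
  moreover have "b \<noteq> 0"
  proof
    assume "b = 0"
    thus False using b d factor_gt_1[OF assms(1)] by simp
  qed
  ultimately show ?thesis using that d by blast
qed

section \<open>The case \<open>m > 0\<close>\<close>

text \<open>If \<open>2\<close> is a Fermi-Dirac factor of \<open>\<sigma>(N)\<close>, then so is \<open>3\<close> of \<open>N\<close>, and these two alone
  contribute \<open>(1 + 1/2) (1 + 1/3) = 2\<close> to the abundancy product.\<close>

lemma m_pos_imp_zero_notin_S:
  assumes "m > 0"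
  shows "0 \<notin> S"
proof
  assume S0: "0 \<in> S"
  define P where "P = (\<Prod>i\<in>S - {0}. 1 + 2 ^ 2 ^ i :: nat)"
  define Q where "Q = q ^ 2 ^ m"
  have eq: "2 * N = 3 * (P * (1 + Q))"
    using sigma_sigma_N S S0 by (simp add: prod.remove P_def Q_def)
  \<comment> \<open>Since 3 is not 1 mod 4, it divides \<open>2 * N\<close> only through the Fermat
    number 3 of index \<open>0\<close>.\<close>
  have "\<not> 3 dvd 1 + Q"
    using prime_dvd_power_plus_1_mod_4[of 3 q m] assms by (auto simp: Q_def)
  moreover have "\<not> 3 dvd P"
    using prime_dvd_power_plus_1_mod_4[of 3 2] S by (auto simp: P_def prime_dvd_prod_iff)
  ultimately have "\<not> 3 dvd P * (1 + Q)"
    using prime_dvd_mult_iff[of 3 P "1 + Q"] by (simp del: mult_Suc_right)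
  hence "multiplicity 3 (2 * N) = 1"
    unfolding eq by (subst prime_elem_multiplicity_mult_distrib)
      (auto simp: not_dvd_imp_multiplicity_0 intro!: Nat.gr0I)
  moreover have "multiplicity 3 (2 * N) = multiplicity 3 N"
    using N_pos by (subst prime_elem_multiplicity_mult_distrib) (auto simp: not_dvd_imp_multiplicity_0)
  ultimately have "3 ^ 2 ^ 0 \<in> fd_factors N"
    by (subst fd_factors_power_iff) auto
  hence mem: "3 \<in> fd_factors N" by simp
  define R where "R = \<Prod>(fd_factors N - {3})"
  have "N = 3 * R"
    using prod_fd_factors[OF N_pos] prod.remove[OF finite_factors mem, of "\<lambda>x. x"] by (simp add: R_def)
  have "2 ^ set_encode S * Q = 4 * (\<Prod>c\<in>fd_factors N - {3}. 1 + c)"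
    using sigma_N prod.remove[OF finite_factors mem, of "\<lambda>x. 1 + x"] by (simp add: Q_def)
  moreover have "R \<le> (\<Prod>c\<in>fd_factors N - {3}. 1 + c)"
    unfolding R_def by (rule prod_mono) auto
  \<comment> \<open>The factor \<open>3\<close> contributes exactly 4/3 to
    \<open>\<sigma>(N) / N\<close>, the other factors at least 1.\<close>
  ultimately have 1: "4 * N \<le> 3 * (2 ^ set_encode S * Q)"
    using \<open>N = 3 * R\<close> by linarith
  have "2 ^ set_encode S = 2 * (\<Prod>i\<in>S - {0}. 2 ^ 2 ^ i :: nat)"
    using S S0 by (simp add: prod_power_eq_power_set_encode[symmetric] prod.remove)
  also have "(\<Prod>i\<in>S - {0}. 2 ^ 2 ^ i :: nat) \<le> P"
    unfolding P_def by (rule prod_mono) auto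
  finally have "2 ^ set_encode S * (1 + Q) \<le> 2 * P * (1 + Q)"
    by (intro mult_right_mono) auto
  hence "3 * (2 ^ set_encode S * (1 + Q)) \<le> 4 * N" using eq by simp
  \<comment> \<open>The surplus of \<open>1 + Q\<close> over \<open>Q\<close> makes the combined
    inequality strict.\<close>
  moreover have "2 ^ set_encode S * (1 + Q) = 2 ^ set_encode S + 2 ^ set_encode S * Q"
    by (simp add: algebra_simps)
  moreover have "(2::nat) ^ set_encode S > 0" by simp
  ultimately show False using 1 by linarith
qed

text \<open>Otherwise the Fermi-Dirac factors of \<open>N\<close> are \<open>2 q\<^sup>b - 1\<close> for distinct \<open>b > 0\<close>, so the abundancy
  product is at most \<open>(4/3) (4/3) (1 + 1/9) = 160/81 < 2\<close>.\<close>

lemma m_pos_imp_zero_in_S: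
  assumes "m > 0"
  shows "0 \<in> S"
proof (rule ccontr)
  assume S0: "0 \<notin> S"
  have "\<exists>b. b > 0 \<and> 1 + c = 2 * q ^ b" if c: "c \<in> fd_factors N" for c
  proof -
    from c obtain p k where p: "c = p ^ 2 ^ k" "prime p" "odd p" "p dvd N" by (rule factorE)
    from p(2,4) have "p mod 4 = 1"
    proof (cases rule: prime_dvd_N_cases)
      case (1 i)
      thus ?thesis using prime_dvd_power_plus_1_mod_4[of p 2 i] p S0 by (metis gr0I)
    next
      case 2
      thus ?thesis using prime_dvd_power_plus_1_mod_4[of p q m] p assms by blast
    qed
    hence "c mod 4 = 1" unfolding p(1) by (rule power_mod_4_eq_1)
    thus ?thesis using factor_mod_4E[OF c] by metis
  qed
  then obtain b where b: "\<And>c. c \<in> fd_factors N \<Longrightarrow> b c > 0 \<and> 1 + c = 2 * q ^ b c" by metis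
  have inj: "inj_on b (fd_factors N)"
    by (rule inj_onI) (metis b add_left_cancel)
  define Q where "Q = q ^ 2 ^ m"
  define M where "M = 2 ^ set_encode S * Q"
  have "(\<Sum>c\<in>fd_factors N. 1 / real q ^ b c) = (\<Sum>k\<in>b ` fd_factors N. 1 / real q ^ k)"
    by (simp add: sum.reindex[OF inj])
  also have "\<dots> \<le> 1 / 2"
    using finite_factors b q_ge_3 by (intro sum_inverse_powers_le) fastforce+
  finally have "(\<Sum>c\<in>fd_factors N. 1 / (2 * real q ^ b c)) \<le> 1 / 4"
    using sum_divide_distrib[of "\<lambda>c. 1 / real q ^ b c" "fd_factors N" 2] by (simp add: mult.commute)
  \<comment> \<open>The product equals \<open>N / \<sigma>(N)\<close>, and the Weierstrass
    inequality bounds it below by \<open>1 - 1 / 4\<close>.\<close>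
  moreover have "1 - (\<Sum>c\<in>fd_factors N. 1 / (2 * real q ^ b c))
      \<le> (\<Prod>c\<in>fd_factors N. 1 - 1 / (2 * real q ^ b c))"
  proof (rule Weierstrass_prod_ineq)
    fix c
    have "real q ^ b c \<ge> 1" using q_ge_3 by simp
    hence "1 / (2 * real q ^ b c) \<le> 1" by (subst divide_le_eq_1_pos) linarith+
    thus "1 / (2 * real q ^ b c) \<in> {0..1}" by simp
  qed
  moreover have "(\<Prod>c\<in>fd_factors N. 1 - 1 / (2 * real q ^ b c)) = real N / real M"
  proof -
    have "1 - 1 / (2 * real q ^ b c) = real c / real (1 + c)" if "c \<in> fd_factors N" for c
    proof -
      have "real (1 + c) = 2 * real q ^ b c" using b[OF that] by (metis of_nat_mult of_nat_numeral of_nat_power)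
      hence "1 - 1 / (2 * real q ^ b c) = 1 - 1 / real (1 + c)" by simp
      also have "\<dots> = real c / real (1 + c)" by (simp add: field_simps)
      finally show ?thesis .
    qed
    hence "(\<Prod>c\<in>fd_factors N. 1 - 1 / (2 * real q ^ b c))
        = (\<Prod>c\<in>fd_factors N. real c / real (1 + c))" by (intro prod.cong) auto
    also have "\<dots> = real (\<Prod>(fd_factors N)) / real (\<Prod>c\<in>fd_factors N. 1 + c)"
      unfolding of_nat_prod by (rule prod_dividef)
    finally show ?thesis unfolding prod_fd_factors[OF N_pos] sigma_N M_def Q_def .
  qed
  ultimately have "3 / 4 \<le> real N / real M" by linarith
  moreover have "M > 0" using q_ge_3 by (auto simp: M_def Q_def)
  ultimately have 1: "3 * real M \<le> 4 * real N" by (simp add: field_simps)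
  have "9 \<le> Q"
  proof -
    have "(3::nat) ^ 2 \<le> 3 ^ 2 ^ m" using assms by (intro power_increasing) (cases m, auto)
    also have "\<dots> \<le> Q" unfolding Q_def using q_ge_3 by (intro power_mono) auto
    finally show ?thesis by simp
  qed
  hence "9 * (1 + Q) \<le> 10 * Q" by simp
  with prod_Fermat_le[OF S S0]
  have "(3 * (\<Prod>i\<in>S. 1 + 2 ^ 2 ^ i)) * (9 * (1 + Q)) \<le> (4 * 2 ^ set_encode S) * (10 * Q)"
    by (rule mult_mono) auto
  hence "27 * (2 * N) \<le> 40 * M" unfolding sigma_sigma_N M_def Q_def by (simp add: algebra_simps)
  \<comment> \<open>With \<open>3 * M \<le> 4 * N\<close> this would give
    \<open>162 * N \<le> 160 * N\<close>.\<close>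
  hence "54 * real N \<le> 40 * real M" by linarith
  thus False using 1 N_pos by linarith
qed

section \<open>The case \<open>m = 0\<close>\<close>

text \<open>Here \<open>q \<parallel> \<sigma>(N)\<close>, so only one Fermi-Dirac factor \<open>c\<close> of \<open>N\<close> has \<open>q dvd 1 + c\<close>. If a Fermat
  number \<open>F\<^sub>i\<close> with \<open>i > 0\<close> occurs, it must equal that factor \<open>2 q - 1\<close>, whence \<open>3 dvd q\<close>.\<close>

lemma m_zero_eq_9:
  assumes "m = 0"
  shows "N = 9"
proof -
  have sN: "(\<Prod>c\<in>fd_factors N. 1 + c) = 2 ^ set_encode S * q" using sigma_N assms by simp
  have q_mod_4: "q mod 4 = 1"
  proof -
    have "1 + q dvd 2 * N" unfolding sigma_sigma_N assms by (metis dvd_triv_right power_0 power_one_right)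
    moreover have "\<not> 4 dvd 2 * N" using N_odd by presburger
    ultimately have "\<not> 4 dvd 1 + q" using dvd_trans by blast
    thus ?thesis using q(2) by presburger
  qed
  have no_i: False if i: "i \<in> S" "i > 0" for i
  proof -
    define F :: nat where "F = 1 + 2 ^ 2 ^ i"
    have F: "F > 1" "odd F" using i by (auto simp: F_def)
    \<comment> \<open>With \<open>m = 0\<close> the exponent of \<open>q\<close> can only be 1, so
      all such factors have the same value.\<close>
    have factor: "p ^ 2 ^ k = 2 * q - 1" if p: "prime p" "p mod 4 = 1" "p ^ 2 ^ k \<in> fd_factors N" for p k
    proof -
      have "p ^ 2 ^ k mod 4 = 1" using p(2) by (rule power_mod_4_eq_1)
      with p(3) obtain b where b: "b > 0" "b \<le> 2 ^ m" "1 + p ^ 2 ^ k = 2 * q ^ b" by (rule factor_mod_4E)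
      hence "b = 1" using assms by simp
      thus ?thesis using b by simp
    qed
    have pF: "p mod 4 = 1 \<and> p dvd 2 * q - 1 \<and> p ^ multiplicity p F = 2 * q - 1"
      if p: "prime p" "p dvd F" for p
    proof -
      have "odd p" using p F dvd_trans by blast
      have p4: "p mod 4 = 1"
        using prime_dvd_power_plus_1_mod_4[of p 2 i] p \<open>odd p\<close> i by (simp add: F_def)
      have "F dvd 2 * N" unfolding sigma_sigma_N F_def using S i(1) by (intro dvd_mult2 dvd_prodI)
      hence "p dvd 2 * N" using p dvd_trans by blast
      hence "p dvd N" using \<open>odd p\<close> p(1) by (metis coprime_dvd_mult_right_iff coprime_right_2_iff_odd)
      hence "multiplicity p N \<noteq> 0"
        using p(1) N_pos by (metis gr_implies_not0 multiplicity_gt_zero_iff not_prime_unit)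
      hence "set_decode (multiplicity p N) \<noteq> {}" by (metis set_decode_inverse set_encode_empty)
      moreover have decode: "p ^ 2 ^ k = 2 * q - 1" if "k \<in> set_decode (multiplicity p N)" for k
        using factor p(1) p4 that by (simp add: fd_factors_power_iff)
      ultimately obtain k where k: "k \<in> set_decode (multiplicity p N)" "p ^ 2 ^ k = 2 * q - 1" by blast
      \<comment> \<open>Every digit gives the same value \<open>2 * q - 1\<close>, so there is only
        one digit.\<close>
      have "set_decode (multiplicity p N) = {k}"
        using k decode fd_primes_power_eq_iff[OF p(1) p(1)] by (metis is_singletonI' is_singleton_def empty_iff singletonD)
      hence "multiplicity p N = 2 ^ k" by (metis set_decode_inverse set_decode_power_2)
      have "p dvd 2 * q - 1" unfolding k(2)[symmetric] by (intro dvd_power) simp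
      have "\<not> p dvd 1 + q"
      proof
        assume "p dvd 1 + q"
        hence "p dvd 2 * (1 + q) - (2 * q - 1)" using \<open>p dvd 2 * q - 1\<close> by (metis dvd_diff_nat dvd_mult)
        also have "2 * (1 + q) - (2 * q - 1) = 3" using q_ge_3 by simp
        finally have "p = 3" by (intro primes_dvd_imp_eq) (use p(1) in simp_all)
        thus False using p4 by simp
      qed
      define P where "P = (\<Prod>j\<in>S - {i}. 1 + 2 ^ 2 ^ j :: nat)"
      have "\<not> p dvd P"
      proof
        assume "p dvd P"
        then obtain j where "j \<in> S - {i}" "p dvd 1 + 2 ^ 2 ^ j"
          using p(1) S by (auto simp: P_def prime_dvd_prod_iff)
        thus False using prime_dvd_Fermat_numbers_unique[of p i j] p \<open>odd p\<close> by (auto simp: F_def add.commute)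
      qed
      \<comment> \<open>The whole \<open>p\<close>-part of \<open>2 * N\<close> comes from
        \<open>F\<close>, since \<open>p\<close> divides no other factor on the right.\<close>
      have "2 * N = F * (P * (1 + q))"
        unfolding sigma_sigma_N F_def P_def prod.remove[OF S i(1)] using assms by (simp only: mult.assoc power_0 power_one_right)
      moreover have "\<not> p dvd P * (1 + q)"
        using p(1) \<open>\<not> p dvd P\<close> \<open>\<not> p dvd 1 + q\<close> prime_dvd_mult_iff by blast
      moreover have "\<not> p dvd 2" using p(1) \<open>odd p\<close> by (metis primes_dvd_imp_eq two_is_prime_nat dvd_refl)
      moreover have "P > 0" using \<open>\<not> p dvd P\<close> by (intro Nat.gr0I) auto
      ultimately have "multiplicity p N = multiplicity p F"
        using p(1) N_pos F prime_elem_multiplicity_mult_distrib[of p 2 N]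
          prime_elem_multiplicity_mult_distrib[of p F "P * (1 + q)"]
        by (simp add: not_dvd_imp_multiplicity_0)
      thus ?thesis using k \<open>multiplicity p N = 2 ^ k\<close> p4 \<open>p dvd 2 * q - 1\<close> by simp
    qed
    obtain p where p: "prime p" "p dvd F" using F(1) prime_factor_nat[of F] by auto
    \<comment> \<open>\<open>2 * q - 1\<close> is a power of \<open>p\<close> and every prime factor
      of \<open>F\<close> divides it, so \<open>p\<close> is the only prime to compare.\<close>
    have "F = 2 * q - 1"
    proof (rule multiplicity_eq_nat)
      fix r :: nat assume r: "prime r"
      show "multiplicity r F = multiplicity r (2 * q - 1)"
      proof (cases "r = p")
        case True
        have "multiplicity p (2 * q - 1) = multiplicity p (p ^ multiplicity p F)" using pF[OF p] by simp
        thus ?thesis using True p(1) by simp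
      next
        case False
        have "\<not> r dvd 2 * q - 1"
          using pF[OF p] r p(1) False by (metis prime_dvd_power primes_dvd_imp_eq)
        hence "\<not> r dvd F" using pF[of r] r by blast
        thus ?thesis using \<open>\<not> r dvd 2 * q - 1\<close> by (simp add: not_dvd_imp_multiplicity_0)
      qed
    qed (use F q_ge_3 in auto)
    hence "2 * q = 2 + 2 ^ 2 ^ i" using q_ge_3 by (simp add: F_def)
    moreover have "(2::nat) ^ 2 ^ i = 4 ^ 2 ^ (i - 1)"
      using i(2) by (cases i) (simp_all add: power_mult)
    ultimately have "2 * q = 2 + 4 ^ 2 ^ (i - 1)" by simp
    moreover have "(4::nat) ^ n mod 3 = 1" for n
      using power_mod[of "4::nat" 3 n] by simp
    ultimately obtain y where "2 * q = 2 + y" "y mod 3 = 1" by blast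
    hence "3 dvd q" by presburger
    hence "3 = q" by (intro primes_dvd_imp_eq) (use q(1) in simp_all)
    thus False using q_mod_4 by simp
  qed
  have "N \<noteq> 1"
  proof
    assume "N = 1"
    hence "fd_factors N = {}" by (auto simp: fd_factors_def)
    hence "2 ^ set_encode S * q = 1" using sN by simp
    thus False using q by simp
  qed
  hence "fd_factors N \<noteq> {}" using prod_fd_factors[OF N_pos] by auto
  then obtain c where c: "c \<in> fd_factors N" by blast
  have "S \<noteq> {}"
  proof
    assume "S = {}"
    hence "1 + c dvd q" using factor_plus_1_dvd[OF c] assms by simp
    thus False using factor_odd[OF c] q(2) by (meson dvd_trans even_plus_one_iff odd_one odd_add)
  qed
  hence "S = {0}" using no_i by (metis gr0I is_singletonI' is_singleton_def singletonD ex_in_conv)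
  hence sN': "(\<Prod>c\<in>fd_factors N. 1 + c) = 2 * q" using sN by (simp add: set_encode_def)
  \<comment> \<open>Each \<open>1 + c\<close> is even, but \<open>2 * q\<close> has only one factor
    2.\<close>
  have "fd_factors N - {c} = {}"
  proof (rule ccontr)
    assume "fd_factors N - {c} \<noteq> {}"
    then obtain d where d: "d \<in> fd_factors N - {c}" by blast
    have "2 dvd 1 + d" "2 dvd 1 + c" using d c factor_odd by auto
    moreover have "1 + d dvd (\<Prod>c\<in>fd_factors N - {c}. 1 + c)"
      using d finite_factors by (intro dvd_prodI) auto
    ultimately have "2 * 2 dvd (1 + c) * (\<Prod>c\<in>fd_factors N - {c}. 1 + c)"
      by (intro mult_dvd_mono) (auto dest: dvd_trans)
    hence "2 * 2 dvd 2 * q"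
      using sN' prod.remove[OF finite_factors c, of "\<lambda>c. 1 + c"] by simp
    thus False using q(2) by simp
  qed
  hence "fd_factors N = {c}" using c by blast
  hence "N = c" "1 + c = 2 * q" using prod_fd_factors[OF N_pos] sN' by auto
  moreover have "2 * N = 3 * (1 + q)" using sigma_sigma_N assms \<open>S = {0}\<close> by simp
  \<comment> \<open>Eliminating \<open>N\<close> gives \<open>q = 5\<close>.\<close>
  ultimately show ?thesis by presburger
qed

end

section \<open>The solution 9 and the reduction to one odd factor\<close>

text \<open>\<open>9 = 3 ^ 2 ^ 1\<close> is a single factor, so the first sum is
  \<open>10 = 2 * 5\<close> and the second is \<open>3 * 6 = 18\<close>.\<close>

lemma infinitary_superperfect_9: "infinitary_superperfect 9"
proof -
  have fd: "p ^ 2 ^ k \<in> fd_primes" if "prime p" for p k :: nat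
    using that by (auto simp: fd_primes_def)
  have "{9::nat} \<subseteq> fd_primes" using fd[of 3 1] by simp
  hence "fd_factors 9 = {9}" using fd_factors_prod[of "{9}"] by simp
  hence "sigma_infinitary 9 = 10" by (simp add: sigma_infinitary_eq_prod)
  moreover have "{2, 5::nat} \<subseteq> fd_primes" using fd[of 2 0] fd[of 5 0] by simp
  hence "fd_factors 10 = {2, 5}" using fd_factors_prod[of "{2, 5}"] by simp
  hence "sigma_infinitary 10 = 18" by (simp add: sigma_infinitary_eq_prod)
  ultimately show ?thesis by (simp add: infinitary_superperfect_def)
qed

text \<open>\<open>2 * N\<close> is even but not divisible by 4, so exactly one factor of
  \<open>\<sigma>(N)\<close> is odd; the others are of the form \<open>2 ^ 2 ^ i\<close>.\<close>

lemma odd_solution_exists: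
  assumes "odd N" "infinitary_superperfect N"
  shows "\<exists>q m S. odd_solution N q m S"
proof -
  have "N > 0" using assms(1) by (rule odd_pos)
  define M where "M = sigma_infinitary N"
  have M: "M = (\<Prod>c\<in>fd_factors N. 1 + c)"
    using \<open>N > 0\<close> by (simp add: M_def sigma_infinitary_eq_prod)
  have "M > 0" unfolding M by (rule prod_pos) simp
  note fin = finite_fd_factors[OF \<open>M > 0\<close>]
  have sM: "2 * N = (\<Prod>x\<in>fd_factors M. 1 + x)"
    using assms(2) \<open>M > 0\<close> by (simp add: infinitary_superperfect_def sigma_infinitary_eq_prod flip: M_def)
  have "\<exists>x\<in>fd_factors M. odd x"
  proof -
    have "even (\<Prod>x\<in>fd_factors M. 1 + x)" unfolding sM[symmetric] by simp
    thus ?thesis using fin by (auto simp: even_prod_iff)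
  qed
  then obtain Q where Q: "Q \<in> fd_factors M" "odd Q" by blast
  have even: "even x" if x: "x \<in> fd_factors M" "x \<noteq> Q" for x
  proof (rule ccontr)
    assume "odd x"
    have "1 + x dvd (\<Prod>x\<in>fd_factors M - {Q}. 1 + x)"
      using x fin by (intro dvd_prodI) auto
    moreover have "2 dvd 1 + x" "2 dvd 1 + Q" using \<open>odd x\<close> Q by auto
    ultimately have "2 * 2 dvd (1 + Q) * (\<Prod>x\<in>fd_factors M - {Q}. 1 + x)"
      by (intro mult_dvd_mono) (auto dest: dvd_trans)
    hence "2 * 2 dvd 2 * N"
      using sM prod.remove[OF fin Q(1), of "\<lambda>c. 1 + c"] by simp
    thus False using assms(1) by simp
  qed
  obtain q m where qm: "Q = q ^ 2 ^ m" "prime q"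
    using Q(1) by (auto simp: fd_factors_def)
  define S where "S = set_decode (multiplicity 2 M)"
  have inj: "inj_on (\<lambda>i. 2 ^ 2 ^ i :: nat) S"
    by (rule inj_onI) (simp add: fd_primes_power_eq_iff)
  have rest: "fd_factors M - {Q} = (\<lambda>i. 2 ^ 2 ^ i) ` S"
  proof (intro equalityI subsetI)
    fix x assume x: "x \<in> fd_factors M - {Q}"
    then obtain p k where p: "x = p ^ 2 ^ k" "prime p" "k \<in> set_decode (multiplicity p M)"
      by (auto simp: fd_factors_def)
    have "even p" using even[of x] x p(1) by simp
    hence "p = 2" using p(2) by (metis primes_dvd_imp_eq two_is_prime_nat)
    thus "x \<in> (\<lambda>i. 2 ^ 2 ^ i) ` S" using p by (auto simp: S_def)
  next
    fix x :: nat assume "x \<in> (\<lambda>i. 2 ^ 2 ^ i) ` S"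
    then obtain i where i: "i \<in> S" "x = 2 ^ 2 ^ i" by blast
    hence "x \<in> fd_factors M" by (simp add: S_def fd_factors_power_iff)
    moreover have "x \<noteq> Q" using i Q(2) by auto
    ultimately show "x \<in> fd_factors M - {Q}" by simp
  qed
  have "finite S" by (simp add: S_def)
  have "odd_solution N q m S"
  proof
    have "M = Q * (\<Prod>i\<in>S. 2 ^ 2 ^ i)"
      using prod_fd_factors[OF \<open>M > 0\<close>] prod.remove[OF fin Q(1), of "\<lambda>x. x"] rest
      by (simp add: prod.reindex[OF inj])
    thus "(\<Prod>c\<in>fd_factors N. 1 + c) = 2 ^ set_encode S * q ^ 2 ^ m"
      using M qm \<open>finite S\<close> by (simp add: prod_power_eq_power_set_encode mult.commute)
    show "2 * N = (\<Prod>i\<in>S. 1 + 2 ^ 2 ^ i) * (1 + q ^ 2 ^ m)"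
      using sM prod.remove[OF fin Q(1), of "\<lambda>x. 1 + x"] rest qm(1)
      by (simp add: prod.reindex[OF inj] mult.commute)
    show "odd q" using Q(2) qm(1) by auto
  qed fact+
  thus ?thesis by blast
qed

theorem theorem1p1:
  fixes N :: nat
  shows "odd N \<and> infinitary_superperfect N \<longleftrightarrow> N = 9"
proof
  assume "odd N \<and> infinitary_superperfect N"
  then obtain q m S where "odd_solution N q m S" using odd_solution_exists by metis
  then interpret odd_solution N q m S .
  have "m = 0" using m_pos_imp_zero_notin_S m_pos_imp_zero_in_S by blast
  thus "N = 9" by (rule m_zero_eq_9)
next
  assume "N = 9"
  thus "odd N \<and> infinitary_superperfect N" using infinitary_superperfect_9 by simp
qed

end
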